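(* For every real Banach space $X$ with $\dim X\ge2$ and every $-\infty\le t<\infty$, $$J^B_{X,t}(\tau)\le M_t\bigl(1+\tau,\,1-\tau+\tau J_B(X)\bigr)\qquad(0\le\tau\le1).$$ Consequently, $$C^B_t(X)\le\sup_{0\le\tau\le1}\frac{M_t\bigl(1+\tau,\,1-\tau+\tau J_B(X)\bigr)^2}{1+\tau^2}.$$
   Context: $S_X$ denotes the unit sphere of $X$. For $x,y\in X$, Birkhoff-James orthogonality $x\perp_B y$ means $\|x+\lambda y\|\ge\|x\|$ for all $\lambda\in\mathbb{R}$. For $a,b>0$ set $M_t(a,b)=\left(\frac{a^t+b^t}{2}\right)^{1/t}$ if $t\in\mathbb{R}\setminus\{0\}$, $M_0(a,b)=\sqrt{ab}$, and $M_{-\infty}(a,b)=\min\{a,b\}$. For $-\infty\le t<\infty$ and $\tau\ge 0$ define $$J^B_{X,t}(\tau)=\sup\{M_t(\|x+\tau y\|,\|x-\tau y\|): x,y\in S_X,\ x\perp_B y\},\qquad C^B_t(X)=\sup_{0\le\tau\le1}\frac{J^B_{X,t}(\tau)^2}{1+\tau^2}.$$ The Birkhoff orthogonal James constant is $J_B(X)=\sup\{\min(\|x+y\|,\|x-y\|):x,y\in S_X,\ x\perp_B y\}$. *)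

theory Defs
  imports "HOL-Analysis.Analysis"
begin

definition birkhoff_orth :: "'a::real_normed_vector \<Rightarrow> 'a \<Rightarrow> bool" where
  "birkhoff_orth x y \<longleftrightarrow> (\<forall>l::real. norm (x + l *\<^sub>R y) \<ge> norm x)"

(* Power mean M_t(a,b), meant for a, b > 0 and -\<infinity> \<le> t < \<infinity>. The value at t = \<infinity> is junk. *)
definition power_mean :: "ereal \<Rightarrow> real \<Rightarrow> real \<Rightarrow> real" where
  "power_mean t a b =
     (if t = -\<infinity> then min a b
      else if t = 0 then sqrt (a * b)
      else ((a powr real_of_ereal t + b powr real_of_ereal t) / 2) powr (1 / real_of_ereal t))"

(* The constants below are invariants of the space 'a, passed as a type token. When the space
   has dimension at least 2, the suprema are over nonempty bounded sets (for t < \<infinity>), so the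
   conditional supremum on the reals is the usual one. *)
definition birkhoff_J :: "'a::real_normed_vector itself \<Rightarrow> ereal \<Rightarrow> real \<Rightarrow> real" where
  "birkhoff_J _ t \<tau> =
     Sup {power_mean t (norm (x + \<tau> *\<^sub>R y)) (norm (x - \<tau> *\<^sub>R y)) | x y :: 'a.
            x \<in> sphere 0 1 \<and> y \<in> sphere 0 1 \<and> birkhoff_orth x y}"

definition birkhoff_C :: "'a::real_normed_vector itself \<Rightarrow> ereal \<Rightarrow> real" where
  "birkhoff_C X t = (SUP \<tau>\<in>{0..1}. (birkhoff_J X t \<tau>)\<^sup>2 / (1 + \<tau>\<^sup>2))"

definition birkhoff_james :: "'a::real_normed_vector itself \<Rightarrow> real" where
  "birkhoff_james _ =
     Sup {min (norm (x + y)) (norm (x - y)) | x y :: 'a.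
            x \<in> sphere 0 1 \<and> y \<in> sphere 0 1 \<and> birkhoff_orth x y}"

(* Stated with an independent set because dim UNIV is 0 for infinite-dimensional spaces. *)
definition dim_at_least :: "'a::real_vector itself \<Rightarrow> nat \<Rightarrow> bool" where
  "dim_at_least _ n \<longleftrightarrow> (\<exists>B :: 'a set. finite B \<and> independent B \<and> card B = n)"

end

theory Submission
  imports Defs
begin

text \<open>
  For a Birkhoff orthogonal pair of unit vectors, replacing $y$ by $-y$ if necessary, assume
  $\|x-y\|\le\|x+y\|$, so that $\|x-y\|\le J_B(X)$. Since $x-\tau y=(1-\tau)x+\tau(x-y)$, the triangle
  inequality gives $\|x-\tau y\|\le 1-\tau+\tau J_B(X)$, while $\|x+\tau y\|\le 1+\tau$. All these numbers
  are at least $1$ by orthogonality, and power means are monotone and symmetric.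
\<close>

lemma power_mean_commute: "power_mean t a b = power_mean t b a"
  by (simp add: power_mean_def min.commute mult.commute add.commute)

lemma power_mean_nonneg:
  assumes "0 \<le> a" "0 \<le> b"
  shows "0 \<le> power_mean t a b"
  using assms by (simp add: power_mean_def)

lemma power_mean_same:
  assumes "0 < a" "t < \<infinity>"
  shows "power_mean t a a = a"
  using assms by (cases t) (auto simp: power_mean_def powr_powr real_sqrt_mult_self)

text \<open>For a negative exponent the inner and the outer power both reverse the order, so their
  composition preserves it; this is where positivity of \<open>a\<close> and \<open>b\<close>
  matters.\<close>

lemma power_mean_mono:
  assumes pos: "0 < a" "0 < b" and le: "a \<le> a'" "b \<le> b'"
  shows "power_mean t a b \<le> power_mean t a' b'"
proof -
  define r where "r = real_of_ereal t"
  have "((a powr r + b powr r) / 2) powr (1 / r) \<le> ((a' powr r + b' powr r) / 2) powr (1 / r)"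
  \<comment> \<open>The first case includes \<open>r = 0\<close>, which arises from
    \<open>t = 0\<close> and from infinite \<open>t\<close>. There \<open>1 / r\<close> is
    \<open>0\<close>, so the power formula still satisfies the inequality and no separate treatment
    is required.\<close>
  proof (cases "0 \<le> r")
    case True
    then have "a powr r \<le> a' powr r" "b powr r \<le> b' powr r"
      using pos le by (auto intro: powr_mono2)
    then show ?thesis
      using True by (intro powr_mono2) auto
  next
    case False
    then have "a' powr r \<le> a powr r" "b' powr r \<le> b powr r"
      using pos le by (auto intro: powr_mono2')
    moreover have "0 < a' powr r + b' powr r"
      using pos le by (intro add_pos_pos) auto
    ultimately show ?thesis
      using False by (intro powr_mono2') auto
  qed
  moreover have "min a b \<le> min a' b'" "a * b \<le> a' * b'"
    using pos le by (auto intro: mult_mono)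
  ultimately show ?thesis
    by (simp add: power_mean_def r_def)
qed

text \<open>Factoring out \<open>c\<close> only rescales the parameter \<open>l\<close>. This serves
  both to normalise an orthogonal pair and to replace \<open>y\<close> by
  \<open>- y\<close>.\<close>

lemma birkhoff_orth_scaleR:
  assumes "birkhoff_orth x y"
  shows "birkhoff_orth (c *\<^sub>R x) (d *\<^sub>R y)"
proof (cases "c = 0")
  case True
  then show ?thesis by (simp add: birkhoff_orth_def)
next
  case False
  show ?thesis
    unfolding birkhoff_orth_def
  proof
    fix l
    have "c *\<^sub>R x + l *\<^sub>R d *\<^sub>R y = c *\<^sub>R (x + (l * d / c) *\<^sub>R y)"
      using False by (simp add: scaleR_add_right)
    moreover have "norm x \<le> norm (x + (l * d / c) *\<^sub>R y)"
      using assms by (simp add: birkhoff_orth_def)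
    ultimately show "norm (c *\<^sub>R x) \<le> norm (c *\<^sub>R x + l *\<^sub>R d *\<^sub>R y)"
      by (simp add: mult_left_mono)
  qed
qed

lemma birkhoff_orth_norm_ge:
  assumes "birkhoff_orth x y"
  shows "norm x \<le> norm (x + l *\<^sub>R y)" "norm x \<le> norm (x - l *\<^sub>R y)"
  using assms unfolding birkhoff_orth_def by (auto dest: spec[of _ "- l"])

text \<open>A point of the line through \<open>u\<close> in direction \<open>v\<close> that has
  least norm is orthogonal to \<open>v\<close>; such a point exists by compactness.\<close>

lemma exists_birkhoff_orth_translate:
  fixes u v :: "'a::real_normed_vector"
  assumes "v \<noteq> 0"
  shows "\<exists>l. birkhoff_orth (u + l *\<^sub>R v) v"
proof -
  \<comment> \<open>For \<open>l\<close> outside \<open>{-R..R}\<close> the vector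
    \<open>l *\<^sub>R v\<close> has norm at least \<open>2 * norm u\<close>, so
    \<open>u + l *\<^sub>R v\<close> is no shorter than \<open>u\<close>, the value at
    \<open>l = 0\<close>. A minimum over the interval is therefore global.\<close>
  define R where "R = 2 * norm u / norm v"
  have "0 \<le> R" by (simp add: R_def)
  then obtain m where m: "\<And>l. l \<in> {-R..R} \<Longrightarrow> norm (u + m *\<^sub>R v) \<le> norm (u + l *\<^sub>R v)"
    using continuous_attains_inf[of "{-R..R}" "\<lambda>l. norm (u + l *\<^sub>R v)"]
    by (force intro: continuous_intros)
  have "norm (u + m *\<^sub>R v) \<le> norm (u + l *\<^sub>R v)" for l
  proof (cases "l \<in> {-R..R}")
    case False
    then have "R * norm v \<le> \<bar>l\<bar> * norm v"
      by (intro mult_right_mono) auto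
    then have "2 * norm u \<le> norm (l *\<^sub>R v)"
      using assms by (simp add: R_def)
    moreover have "norm (l *\<^sub>R v) \<le> norm (u + l *\<^sub>R v) + norm u"
      using norm_triangle_ineq4[of "u + l *\<^sub>R v" u] by simp
    moreover have "norm (u + m *\<^sub>R v) \<le> norm u"
      using m[of 0] \<open>0 \<le> R\<close> by simp
    ultimately show ?thesis by linarith
  qed (rule m)
  then have "birkhoff_orth (u + m *\<^sub>R v) v"
    by (simp add: birkhoff_orth_def add.assoc flip: scaleR_add_left)
  then show ?thesis ..
qed

text \<open>Makes the suprema range over nonempty sets. Independence keeps the orthogonal translate
  of \<open>u\<close> nonzero, so that it can be normalised.\<close>

lemma exists_birkhoff_orth_unit:
  assumes "dim_at_least TYPE('a::real_normed_vector) 2"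
  shows "\<exists>x y :: 'a. norm x = 1 \<and> norm y = 1 \<and> birkhoff_orth x y"
proof -
  obtain u v :: 'a where uv: "u \<noteq> v" "independent {u, v}"
    using assms by (auto simp: dim_at_least_def card_2_iff)
  then have "v \<noteq> 0" and span: "u \<notin> span {v}"
    using dependent_zero[of "{u, v}"] by (auto simp: independent_insert)
  then obtain l where l: "birkhoff_orth (u + l *\<^sub>R v) v"
    using exists_birkhoff_orth_translate by blast
  have "u + l *\<^sub>R v \<noteq> 0"
  proof
    assume "u + l *\<^sub>R v = 0"
    then have "u = (- l) *\<^sub>R v"
      by (simp add: eq_neg_iff_add_eq_0)
    then show False
      using span by (metis span_base span_scale singletonI)
  qed
  then have "norm (sgn (u + l *\<^sub>R v)) = 1" "norm (sgn v) = 1"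
    using \<open>v \<noteq> 0\<close> by (simp_all add: norm_sgn)
  moreover have "birkhoff_orth (sgn (u + l *\<^sub>R v)) (sgn v)"
    using birkhoff_orth_scaleR[OF l] by (simp add: sgn_div_norm)
  ultimately show ?thesis by blast
qed

lemma norm_min_le_birkhoff_james:
  fixes x y :: "'a::real_normed_vector"
  assumes "norm x = 1" "norm y = 1" "birkhoff_orth x y"
  shows "min (norm (x + y)) (norm (x - y)) \<le> birkhoff_james TYPE('a)"
proof -
  have "min (norm (a + b)) (norm (a - b)) \<le> 2" if "norm a = 1" "norm b = 1" for a b :: 'a
    using norm_triangle_ineq[of a b] that by simp
  then have "bdd_above {min (norm (x + y)) (norm (x - y)) | x y :: 'a.
            x \<in> sphere 0 1 \<and> y \<in> sphere 0 1 \<and> birkhoff_orth x y}"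
    by (auto intro!: bdd_aboveI[of _ 2])
  then show ?thesis
    unfolding birkhoff_james_def using assms by (intro cSup_upper) auto
qed

text \<open>Orthogonality of one pair gives the lower bound, the triangle inequality the upper one.
  Together they place \<open>1 - \<tau> + \<tau> * J\<close> in the interval from 1 to 2, where
  \<open>J\<close> is the James constant.\<close>

lemma birkhoff_james_bounds:
  assumes "dim_at_least TYPE('a::real_normed_vector) 2"
  shows "1 \<le> birkhoff_james TYPE('a)" "birkhoff_james TYPE('a) \<le> 2"
proof -
  obtain x y :: 'a where xy: "norm x = 1" "norm y = 1" "birkhoff_orth x y"
    using exists_birkhoff_orth_unit[OF assms] by blast
  show "1 \<le> birkhoff_james TYPE('a)"
    using norm_min_le_birkhoff_james[OF xy] birkhoff_orth_norm_ge[OF xy(3), of 1] xy by simp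
  have "min (norm (a + b)) (norm (a - b)) \<le> 2" if "norm a = 1" "norm b = 1" for a b :: 'a
    using norm_triangle_ineq[of a b] that by simp
  then show "birkhoff_james TYPE('a) \<le> 2"
    unfolding birkhoff_james_def using xy by (intro cSup_least) auto
qed

lemma power_mean_birkhoff_orth_le:
  fixes x y :: "'a::real_normed_vector"
  assumes xy: "norm x = 1" "norm y = 1" "birkhoff_orth x y"
    and tau: "0 \<le> \<tau>" "\<tau> \<le> 1"
  shows "power_mean t (norm (x + \<tau> *\<^sub>R y)) (norm (x - \<tau> *\<^sub>R y))
           \<le> power_mean t (1 + \<tau>) (1 - \<tau> + \<tau> * birkhoff_james TYPE('a))"
proof -
  let ?J = "birkhoff_james TYPE('a)"
  \<comment> \<open>The case where the minus sign gives the small norm, stated for a general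
    \<open>z\<close> so that it applies to \<open>y\<close> and to \<open>- y\<close>.\<close>
  have *: "power_mean t (norm (x + \<tau> *\<^sub>R z)) (norm (x - \<tau> *\<^sub>R z)) \<le> power_mean t (1 + \<tau>) (1 - \<tau> + \<tau> * ?J)"
    if z: "norm z = 1" "birkhoff_orth x z" "norm (x - z) \<le> ?J" for z
  proof (rule power_mean_mono)
    show "0 < norm (x + \<tau> *\<^sub>R z)" "0 < norm (x - \<tau> *\<^sub>R z)"
      using birkhoff_orth_norm_ge[OF z(2), of \<tau>] xy(1) by linarith+
    show "norm (x + \<tau> *\<^sub>R z) \<le> 1 + \<tau>"
      using norm_triangle_ineq[of x "\<tau> *\<^sub>R z"] xy z tau by simp
    have "x - \<tau> *\<^sub>R z = (1 - \<tau>) *\<^sub>R x + \<tau> *\<^sub>R (x - z)"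
      by (simp add: algebra_simps)
    also have "norm \<dots> \<le> (1 - \<tau>) + \<tau> * norm (x - z)"
      using norm_triangle_ineq[of "(1 - \<tau>) *\<^sub>R x" "\<tau> *\<^sub>R (x - z)"] xy tau by simp
    also have "\<dots> \<le> 1 - \<tau> + \<tau> * ?J"
      using z tau by (simp add: mult_left_mono)
    finally show "norm (x - \<tau> *\<^sub>R z) \<le> 1 - \<tau> + \<tau> * ?J" .
  qed
  show ?thesis
  proof (cases "norm (x - y) \<le> ?J")
    case True
    with * xy show ?thesis by blast
  next
    case False
    then have "norm (x + y) \<le> ?J"
      using norm_min_le_birkhoff_james[OF xy] by linarith
    \<comment> \<open>Passing to \<open>- y\<close> exchanges the two norms, which the symmetry of
      the power mean undoes.\<close>
    moreover have "birkhoff_orth x (- y)"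
      using birkhoff_orth_scaleR[OF xy(3), of 1 "-1"] by simp
    ultimately show ?thesis
      using *[of "- y"] xy(2) by (simp add: power_mean_commute)
  qed
qed

text \<open>The lower bound is what allows the upper bound to be squared later.\<close>

lemma birkhoff_J_bounds:
  assumes "dim_at_least TYPE('a::real_normed_vector) 2"
    and tau: "0 \<le> \<tau>" "\<tau> \<le> 1"
  shows "0 \<le> birkhoff_J TYPE('a) t \<tau>"
    and "birkhoff_J TYPE('a) t \<tau> \<le> power_mean t (1 + \<tau>) (1 - \<tau> + \<tau> * birkhoff_james TYPE('a))"
proof -
  obtain x y :: 'a where xy: "norm x = 1" "norm y = 1" "birkhoff_orth x y"
    using exists_birkhoff_orth_unit[OF assms(1)] by blast
  let ?S = "{power_mean t (norm (x + \<tau> *\<^sub>R y)) (norm (x - \<tau> *\<^sub>R y)) | x y :: 'a.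
            x \<in> sphere 0 1 \<and> y \<in> sphere 0 1 \<and> birkhoff_orth x y}"
  let ?b = "power_mean t (1 + \<tau>) (1 - \<tau> + \<tau> * birkhoff_james TYPE('a))"
  have ub: "s \<le> ?b" if "s \<in> ?S" for s
    using that power_mean_birkhoff_orth_le[OF _ _ _ tau] by auto
  have mem: "power_mean t (norm (x + \<tau> *\<^sub>R y)) (norm (x - \<tau> *\<^sub>R y)) \<in> ?S"
    using xy by auto
  show "birkhoff_J TYPE('a) t \<tau> \<le> ?b"
    unfolding birkhoff_J_def using mem ub by (intro cSup_least) blast+
  have "0 \<le> power_mean t (norm (x + \<tau> *\<^sub>R y)) (norm (x - \<tau> *\<^sub>R y))"
    by (simp add: power_mean_nonneg)
  also have "\<dots> \<le> birkhoff_J TYPE('a) t \<tau>"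
    unfolding birkhoff_J_def using mem ub by (intro cSup_upper bdd_aboveI) blast+
  finally show "0 \<le> birkhoff_J TYPE('a) t \<tau>" .
qed

theorem theorem8:
  fixes t :: ereal
  assumes dim: "dim_at_least TYPE('a::banach) 2"
    and t: "-\<infinity> \<le> t" "t < \<infinity>"
  shows "(\<forall>\<tau>::real. 0 \<le> \<tau> \<and> \<tau> \<le> 1 \<longrightarrow>
            birkhoff_J TYPE('a) t \<tau> \<le> power_mean t (1 + \<tau>) (1 - \<tau> + \<tau> * birkhoff_james TYPE('a)))
       \<and> birkhoff_C TYPE('a) t \<le>
            (SUP \<tau>\<in>{0..1::real}. (power_mean t (1 + \<tau>) (1 - \<tau> + \<tau> * birkhoff_james TYPE('a)))\<^sup>2 / (1 + \<tau>\<^sup>2))"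
proof
  let ?J = "birkhoff_james TYPE('a)"
  let ?M = "\<lambda>\<tau>. power_mean t (1 + \<tau>) (1 - \<tau> + \<tau> * ?J)"
  show "\<forall>\<tau>. 0 \<le> \<tau> \<and> \<tau> \<le> 1 \<longrightarrow> birkhoff_J TYPE('a) t \<tau> \<le> ?M \<tau>"
    using birkhoff_J_bounds(2)[OF dim] by blast
  \<comment> \<open>A crude uniform bound, from \<open>?M \<tau> \<le> 2\<close> and a denominator
    of at least 1. It makes the real supremum on the right-hand side a genuine least upper
    bound.\<close>
  have bound: "(?M \<tau>)\<^sup>2 / (1 + \<tau>\<^sup>2) \<le> 4" if "\<tau> \<in> {0..1}" for \<tau>
  proof -
    have "0 \<le> \<tau> * (?J - 1)" "0 \<le> \<tau> * (2 - ?J)"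
      using birkhoff_james_bounds[OF dim] that by auto
    then have J: "1 \<le> 1 - \<tau> + \<tau> * ?J" "1 - \<tau> + \<tau> * ?J \<le> 2"
      using that by (auto simp: algebra_simps)
    then have "?M \<tau> \<le> power_mean t 2 2"
      using that by (intro power_mean_mono) auto
    also have "\<dots> = 2"
      using t by (simp add: power_mean_same)
    finally have "(?M \<tau>)\<^sup>2 \<le> 2\<^sup>2"
      using that J by (intro power_mono power_mean_nonneg) auto
    then have "(?M \<tau>)\<^sup>2 \<le> 4 * (1 + \<tau>\<^sup>2)"
      by (rule order_trans) simp
    then show ?thesis
      by (simp add: pos_divide_le_eq add_pos_nonneg)
  qed
  show "birkhoff_C TYPE('a) t \<le> (SUP \<tau>\<in>{0..1}. (?M \<tau>)\<^sup>2 / (1 + \<tau>\<^sup>2))"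
    unfolding birkhoff_C_def
  proof (rule cSUP_mono)
    show "bdd_above ((\<lambda>\<tau>. (?M \<tau>)\<^sup>2 / (1 + \<tau>\<^sup>2)) ` {0..1})"
      using bound by (rule bdd_aboveI2)
    \<comment> \<open>The comparison is pointwise, with \<open>\<sigma> = \<tau>\<close>.\<close>
    show "\<exists>\<sigma>\<in>{0..1}. (birkhoff_J TYPE('a) t \<tau>)\<^sup>2 / (1 + \<tau>\<^sup>2) \<le> (?M \<sigma>)\<^sup>2 / (1 + \<sigma>\<^sup>2)"
      if "\<tau> \<in> {0..1}" for \<tau>
      using that birkhoff_J_bounds[OF dim, of \<tau> t]
      by (intro bexI[of _ \<tau>] divide_right_mono power_mono) auto
  qed simp
qed

end
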